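(* Let $\varphi$ be a convex analytic function in the unit disk $\mathbb{D}$ with $\varphi(0)=0$ and $\varphi'(0)=1$. Assume that every harmonic mapping $f=h+\overline g\in S_H^0$ satisfying \[ h+g=\varphi,\qquad g'/h'=\omega, \] where $\omega$ is a Schwarz function, is convex. Then each such $f$ is a rotation of a function $F=H+\overline G$ (with canonical decomposition $H,G$) such that $H+G$ belongs to the family $\mathcal A$.
   Context: $\mathbb{D}=\{z\in\mathbb{C}:|z|<1\}$. A univalent (analytic or harmonic) function in $\mathbb{D}$ is called convex if it maps $\mathbb{D}$ onto a convex domain. Every complex-valued harmonic function $f$ in $\mathbb{D}$ has a canonical decomposition $f=h+\overline g$ with $h,g$ analytic in $\mathbb{D}$ and $g(0)=0$. It is orientation-preserving if $|h'|^2-|g'|^2>0$ in $\mathbb{D}$; then its dilatation $\omega=g'/h'$ is analytic with $\omega(\mathbb{D})\subset\mathbb{D}$. $S_H^0$ is the class of orientation-preserving univalent harmonic mappings $f=h+\overline g$ in $\mathbb{D}$ with $h(0)=g(0)=0$, $h'(0)=1$, $g'(0)=0$. A Schwarz function is an analytic function $\omega$ in $\mathbb{D}$ with $\omega(0)=0$ and $\omega(\mathbb{D})\subset\mathbb{D}$. For $|\xi|=1$, the rotation $f_\xi$ of a function $f$ is $f_\xi(z)=\overline\xi f(\xi z)$, $z\in\mathbb{D}$. A function is a rotation of $F$ if it equals $F_\xi$ for some $|\xi|=1$. The family $\mathcal A$ is \[ \mathcal A=\{\mathcal H,\ \mathcal H_{-1},\ \mathcal L_\lambda : \lambda\in\partial\mathbb{D}\setminus\{-1,1\}\},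 \] where, for $z\in\mathbb{D}$, $\mathcal H(z)=\dfrac{z}{1-z}$, $\mathcal H_{-1}(z)=-\mathcal H(-z)$ is the rotation of $\mathcal H$ with $\xi=-1$, and $\mathcal L_\lambda(z)=\dfrac{1}{2i\,\mathrm{Im}\,\lambda}\log\dfrac{1-\overline\lambda z}{1-\lambda z}$ (the analytic branch of the logarithm vanishing at $z=0$). *)

theory Defs
  imports "HOL-Complex_Analysis.Complex_Analysis"
begin

(* Functions on the unit disc are total functions on complex whose values off the disc are
   irrelevant, so every predicate below only looks at the disc. *)

abbreviation unit_disc :: "complex set" where
  "unit_disc \<equiv> ball 0 1"

definition convex_mapping :: "(complex \<Rightarrow> complex) \<Rightarrow> bool" where
  "convex_mapping f \<longleftrightarrow>
     inj_on f unit_disc \<and> open (f ` unit_disc) \<and> convex (f ` unit_disc)"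

definition canonical_decomposition ::
    "(complex \<Rightarrow> complex) \<Rightarrow> (complex \<Rightarrow> complex) \<Rightarrow> (complex \<Rightarrow> complex) \<Rightarrow> bool" where
  "canonical_decomposition f h g \<longleftrightarrow>
     h holomorphic_on unit_disc \<and> g holomorphic_on unit_disc \<and> g 0 = 0 \<and>
     (\<forall>z\<in>unit_disc. f z = h z + cnj (g z))"

(* The class S_H^0 of normalized orientation-preserving univalent harmonic mappings. The canonical
   decomposition (h, g) is carried along; on the disc it is determined by f. *)
definition SH0 ::
    "(complex \<Rightarrow> complex) \<Rightarrow> (complex \<Rightarrow> complex) \<Rightarrow> (complex \<Rightarrow> complex) \<Rightarrow> bool" where
  "SH0 f h g \<longleftrightarrow>
     canonical_decomposition f h g \<and> inj_on f unit_disc \<and>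
     (\<forall>z\<in>unit_disc. (cmod (deriv h z))\<^sup>2 - (cmod (deriv g z))\<^sup>2 > 0) \<and>
     h 0 = 0 \<and> g 0 = 0 \<and> deriv h 0 = 1 \<and> deriv g 0 = 0"

definition schwarz_function :: "(complex \<Rightarrow> complex) \<Rightarrow> bool" where
  "schwarz_function \<omega> \<longleftrightarrow>
     \<omega> holomorphic_on unit_disc \<and> \<omega> 0 = 0 \<and> \<omega> ` unit_disc \<subseteq> unit_disc"

definition rotation :: "complex \<Rightarrow> (complex \<Rightarrow> complex) \<Rightarrow> complex \<Rightarrow> complex" where
  "rotation \<xi> f z = cnj \<xi> * f (\<xi> * z)"

definition is_rotation_of :: "(complex \<Rightarrow> complex) \<Rightarrow> (complex \<Rightarrow> complex) \<Rightarrow> bool" where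
  "is_rotation_of f F \<longleftrightarrow> (\<exists>\<xi>. cmod \<xi> = 1 \<and> (\<forall>z\<in>unit_disc. f z = rotation \<xi> F z))"

definition halfplane_map :: "complex \<Rightarrow> complex" where
  "halfplane_map z = z / (1 - z)"

definition strip_map :: "complex \<Rightarrow> complex \<Rightarrow> complex" where
  "strip_map \<mu> z =
     1 / (2 * \<i> * of_real (Im \<mu>)) * Ln ((1 - cnj \<mu> * z) / (1 - \<mu> * z))"

(* The principal branch Ln is the analytic branch vanishing at z = 0: the quotient never meets
   the branch cut. *)
lemma strip_quotient_not_nonpos:
  assumes "cmod \<mu> = 1" and "z \<in> unit_disc"
  shows "(1 - cnj \<mu> * z) / (1 - \<mu> * z) \<notin> \<real>\<^sub>\<le>\<^sub>0"
proof
  assume "(1 - cnj \<mu> * z) / (1 - \<mu> * z) \<in> \<real>\<^sub>\<le>\<^sub>0"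
  then obtain t where t: "t \<ge> 0" "(1 - cnj \<mu> * z) / (1 - \<mu> * z) = - of_real t"
    by (elim nonpos_Reals_cases) (metis minus_minus neg_0_le_iff_le of_real_minus)
  have z: "cmod z < 1" using assms by simp
  have "1 - \<mu> * z \<noteq> 0"
    using assms z by (metis eq_iff_diff_eq_0 less_irrefl mult_1 norm_mult norm_one)
  with t have "of_real (1 + t) = (cnj \<mu> + of_real t * \<mu>) * z"
    by (simp add: field_simps)
  then have "1 + t = cmod (cnj \<mu> + of_real t * \<mu>) * cmod z"
    using t(1) by (metis abs_of_nonneg add_nonneg_nonneg norm_mult norm_of_real zero_le_one)
  also have "\<dots> \<le> (1 + t) * cmod z"
  proof (rule mult_right_mono)
    show "cmod (cnj \<mu> + of_real t * \<mu>) \<le> 1 + t"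
      using norm_triangle_ineq[of "cnj \<mu>" "of_real t * \<mu>"] assms t(1)
      by (simp add: norm_mult)
  qed simp
  also have "\<dots> < 1 + t" using z t(1) by simp
  finally show False by simp
qed

definition family_A :: "(complex \<Rightarrow> complex) set" where
  "family_A = {halfplane_map, rotation (-1) halfplane_map} \<union>
     {strip_map \<mu> | \<mu>. \<mu> \<in> sphere 0 1 - {-1, 1}}"

end

theory Submission
  imports Defs
begin

text \<open>On the convex domain \<open>D = \<phi> ` unit_disc\<close> the mapping \<open>f = h + cnj g\<close> becomes the vertical shear
  \<open>w \<mapsto> Re w + \<i> Im (Q w)\<close>, where \<open>Q' = (1 - \<omega>) / (1 + \<omega>)\<close> is an arbitrary function with positive
  real part normalized at \<open>0\<close>.  If some vertical line meets \<open>D\<close> without being contained in it, a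
  \<open>Q\<close> with a logarithmic singularity at a boundary point on this line yields a nonconvex image.
  Hence \<open>D\<close> is invariant under vertical translations, that is, a vertical half-plane or strip (the
  plane is excluded by Liouville), and the Schwarz lemma identifies \<open>\<phi>\<close> itself as a member of the
  family, so that the rotation can be taken trivial.\<close>

section \<open>Harmonic mappings with \<open>h + g = \<phi>\<close> as vertical shears\<close>

text \<open>For \<open>f = h + cnj g\<close> one has \<open>Re f = Re (h + g)\<close> and
  \<open>Im f = Im (h - g)\<close>; if \<open>h + g = \<phi>\<close> and \<open>h - g\<close> is
  \<open>Q\<close> after \<open>\<phi>\<close>, then \<open>f\<close> is this map after
  \<open>\<phi>\<close>.\<close>

definition vertical_shear :: "(complex \<Rightarrow> complex) \<Rightarrow> complex \<Rightarrow> complex" where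
  "vertical_shear Q w = Complex (Re w) (Im (Q w))"

text \<open>The real part fixes the vertical line, and along it \<open>Im Q\<close> grows with
  height at rate \<open>Re P > 0\<close>.\<close>

lemma inj_on_vertical_shear:
  assumes D: "convex D"
    and der: "\<And>w. w \<in> D \<Longrightarrow> (Q has_field_derivative P w) (at w)"
    and pos: "\<And>w. w \<in> D \<Longrightarrow> Re (P w) > 0"
  shows "inj_on (vertical_shear Q) D"
proof (rule inj_onI)
  fix x y assume xy: "x \<in> D" "y \<in> D" "vertical_shear Q x = vertical_shear Q y"
  hence e: "Re x = Re y" "Im (Q x) = Im (Q y)" by (auto simp: vertical_shear_def)
  have sub: "closed_segment x y \<subseteq> D"
    using D xy by (simp add: closed_segment_subset)
  \<comment> \<open>The factor \<open>- \<i>\<close> turns \<open>Im Q\<close> into the real part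
    that the complex mean value theorem controls; \<open>y - x\<close> is purely imaginary.\<close>
  have "\<exists>u. u \<in> closed_segment x y \<and>
      Re (- \<i> * Q y) - Re (- \<i> * Q x) = Re ((- \<i> * P u) * (y - x))"
    by (rule complex_mvt_line) (use sub der in \<open>auto intro!: derivative_eq_intros\<close>)
  then obtain u where "u \<in> D" "Re (P u) * (Im y - Im x) = 0"
    using sub e by (auto simp: algebra_simps)
  with pos[of u] e show "x = y" by (auto simp: complex_eq_iff)
qed

text \<open>Supplies the mappings to which the convexity hypothesis is applied. The derivatives of
  \<open>h\<close> and \<open>g\<close> are \<open>deriv \<phi>\<close> times
  \<open>(1 + P) / 2\<close> and \<open>(1 - P) / 2\<close>, so the Jacobian is
  \<open>|\<phi>'|^2 Re P\<close> and the dilatation is a Cayley transform of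
  \<open>P\<close>.\<close>

lemma SH0_vertical_shear:
  assumes hol: "\<phi> holomorphic_on unit_disc" and inj: "inj_on \<phi> unit_disc"
    and cv: "convex (\<phi> ` unit_disc)" and zero: "\<phi> 0 = 0" and d1: "deriv \<phi> 0 = 1"
    and der: "\<And>w. w \<in> \<phi> ` unit_disc \<Longrightarrow> (Q has_field_derivative P w) (at w)"
    and pos: "\<And>w. w \<in> \<phi> ` unit_disc \<Longrightarrow> Re (P w) > 0"
    and Q0: "Q 0 = 0" and P0: "P 0 = 1"
  defines "h \<equiv> \<lambda>z. (\<phi> z + Q (\<phi> z)) / 2" and "g \<equiv> \<lambda>z. (\<phi> z - Q (\<phi> z)) / 2"
    and "\<omega> \<equiv> \<lambda>z. (1 - P (\<phi> z)) / (1 + P (\<phi> z))"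
  shows "SH0 (\<lambda>z. vertical_shear Q (\<phi> z)) h g" "schwarz_function \<omega>"
    "\<forall>z\<in>unit_disc. deriv g z / deriv h z = \<omega> z"
proof -
  let ?D = "\<phi> ` unit_disc"
  have opD: "open ?D"
    by (rule open_mapping_thm3[OF hol _ inj]) auto
  have holQ: "Q holomorphic_on ?D"
    using der opD by (auto simp: holomorphic_on_open)
  have "deriv Q holomorphic_on ?D" using holQ opD by (rule holomorphic_deriv)
  hence holP: "P holomorphic_on ?D"
    by (rule holomorphic_transform) (use der DERIV_imp_deriv in blast)
  have holPc: "(\<lambda>z. P (\<phi> z)) holomorphic_on unit_disc"
    using holomorphic_on_compose_gen[OF hol holP] by (simp add: o_def)
  have holQc: "(\<lambda>z. Q (\<phi> z)) holomorphic_on unit_disc"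
    using holomorphic_on_compose_gen[OF hol holQ] by (simp add: o_def)
  have d\<phi>: "(\<phi> has_field_derivative deriv \<phi> z) (at z)" if "z \<in> unit_disc" for z
    using hol that by (metis holomorphic_derivI open_ball)
  have dQ: "((\<lambda>z. Q (\<phi> z)) has_field_derivative P (\<phi> z) * deriv \<phi> z) (at z)"
    if "z \<in> unit_disc" for z
    by (rule DERIV_chain2[OF der d\<phi>]) (use that in auto)
  have dh: "deriv h z = deriv \<phi> z * (1 + P (\<phi> z)) / 2" if "z \<in> unit_disc" for z
    unfolding h_def using d\<phi>[OF that] dQ[OF that]
    by (intro DERIV_imp_deriv) (auto intro!: derivative_eq_intros simp: algebra_simps)
  have dg: "deriv g z = deriv \<phi> z * (1 - P (\<phi> z)) / 2" if "z \<in> unit_disc" for z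
    unfolding g_def using d\<phi>[OF that] dQ[OF that]
    by (intro DERIV_imp_deriv) (auto intro!: derivative_eq_intros simp: field_simps)
  have nz: "deriv \<phi> z \<noteq> 0" if "z \<in> unit_disc" for z
    using holomorphic_injective_imp_regular[OF hol open_ball inj that] .
  have P1: "1 + P (\<phi> z) \<noteq> 0" if "z \<in> unit_disc" for z
    using pos[of "\<phi> z"] that by (auto simp: complex_eq_iff)
  \<comment> \<open>This identity yields both the positive Jacobian and
    \<open>cmod (\<omega> z) < 1\<close>.\<close>
  have sq: "(cmod (1 + p))\<^sup>2 - (cmod (1 - p))\<^sup>2 = 4 * Re p" for p
    unfolding cmod_power2 by (simp add: algebra_simps power2_eq_square)
  show "SH0 (\<lambda>z. vertical_shear Q (\<phi> z)) h g"
    unfolding SH0_def canonical_decomposition_def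
  proof (intro conjI ballI)
    show "h holomorphic_on unit_disc" "g holomorphic_on unit_disc"
      unfolding h_def g_def by (intro holomorphic_intros hol holQc; simp)+
    show "inj_on (\<lambda>z. vertical_shear Q (\<phi> z)) unit_disc"
      using comp_inj_on[OF inj inj_on_vertical_shear[OF cv der pos]] by (simp add: o_def)
    show "0 < (cmod (deriv h z))\<^sup>2 - (cmod (deriv g z))\<^sup>2" if z: "z \<in> unit_disc" for z
    proof -
      have "(cmod (deriv h z))\<^sup>2 = (cmod (deriv \<phi> z))\<^sup>2 / 4 * (cmod (1 + P (\<phi> z)))\<^sup>2"
        "(cmod (deriv g z))\<^sup>2 = (cmod (deriv \<phi> z))\<^sup>2 / 4 * (cmod (1 - P (\<phi> z)))\<^sup>2"
        by (simp_all add: dh[OF z] dg[OF z] norm_mult norm_divide power_divide power_mult_distrib)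
      hence "(cmod (deriv h z))\<^sup>2 - (cmod (deriv g z))\<^sup>2 =
          (cmod (deriv \<phi> z))\<^sup>2 / 4 * ((cmod (1 + P (\<phi> z)))\<^sup>2 - (cmod (1 - P (\<phi> z)))\<^sup>2)"
        by (simp only: right_diff_distrib)
      thus ?thesis using nz[OF z] pos[of "\<phi> z"] z by (simp add: sq)
    qed
    show "vertical_shear Q (\<phi> z) = h z + cnj (g z)" if "z \<in> unit_disc" for z
      by (simp add: vertical_shear_def h_def g_def complex_eq_iff field_simps)
    show "deriv h 0 = 1" "deriv g 0 = 0" by (simp_all add: dh dg zero P0 d1)
  qed (simp_all add: h_def g_def zero Q0)
  show "schwarz_function \<omega>"
    unfolding schwarz_function_def
  proof (intro conjI)
    show "\<omega> holomorphic_on unit_disc"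
      unfolding \<omega>_def by (intro holomorphic_intros holPc) (use P1 in auto)
    have "cmod (\<omega> z) < 1" if z: "z \<in> unit_disc" for z
    proof -
      have "(cmod (1 - P (\<phi> z)))\<^sup>2 < (cmod (1 + P (\<phi> z)))\<^sup>2"
        using sq[of "P (\<phi> z)"] pos[of "\<phi> z"] z by simp
      hence "cmod (1 - P (\<phi> z)) < cmod (1 + P (\<phi> z))" by (rule power_less_imp_less_base) simp
      thus ?thesis using P1[OF z] by (simp add: \<omega>_def norm_divide divide_simps)
    qed
    thus "\<omega> ` unit_disc \<subseteq> unit_disc" by auto
  qed (simp add: \<omega>_def zero P0)
  show "\<forall>z\<in>unit_disc. deriv g z / deriv h z = \<omega> z"
    using nz P1 by (simp add: dh dg \<omega>_def)
qed

text \<open>Adding a constant to \<open>Q\<close>, a real multiple of \<open>\<i> w\<close> to it, or scaling it by a positive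
  factor changes the image of the shear by a real affine map, so the normalization \<open>P 0 = 1\<close>,
  \<open>Q 0 = 0\<close> is immaterial for convexity.\<close>

lemma convex_vertical_shear_image:
  assumes hol: "\<phi> holomorphic_on unit_disc" and inj: "inj_on \<phi> unit_disc"
    and cv: "convex (\<phi> ` unit_disc)" and zero: "\<phi> 0 = 0" and d1: "deriv \<phi> 0 = 1"
    and all: "\<And>f h g \<omega>. SH0 f h g \<Longrightarrow> schwarz_function \<omega> \<Longrightarrow>
           (\<forall>z\<in>unit_disc. h z + g z = \<phi> z) \<Longrightarrow>
           (\<forall>z\<in>unit_disc. deriv g z / deriv h z = \<omega> z) \<Longrightarrow> convex_mapping f"
    and der: "\<And>w. w \<in> \<phi> ` unit_disc \<Longrightarrow> (Q has_field_derivative P w) (at w)"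
    and pos: "\<And>w. w \<in> \<phi> ` unit_disc \<Longrightarrow> Re (P w) > 0"
  shows "convex (vertical_shear Q ` \<phi> ` unit_disc)"
proof -
  have 0: "0 \<in> \<phi> ` unit_disc" using zero by (metis centre_in_ball image_eqI zero_less_one)
  define r where "r = Re (P 0)"
  define s where "s = Im (P 0)"
  have r: "r > 0" using pos[OF 0] by (simp add: r_def)
  define q where "q = (\<lambda>w. (Q w - Q 0 - \<i> * s * w) / r)"
  define p where "p = (\<lambda>w. (P w - \<i> * s) / r)"
  have derq: "(q has_field_derivative p w) (at w)" if "w \<in> \<phi> ` unit_disc" for w
    unfolding q_def p_def using der[OF that] r by (auto intro!: derivative_eq_intros)
  have posp: "Re (p w) > 0" if "w \<in> \<phi> ` unit_disc" for w
    using pos[OF that] r by (simp add: p_def)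
  have q0: "q 0 = 0" "p 0 = 1"
    using r by (auto simp: q_def p_def r_def s_def complex_eq_iff)
  note S = SH0_vertical_shear[OF hol inj cv zero d1 derq posp q0]
  have "convex_mapping (\<lambda>z. vertical_shear q (\<phi> z))"
    by (rule all[OF S(1) S(2) _ S(3)]) (auto simp: field_simps)
  hence C: "convex (vertical_shear q ` \<phi> ` unit_disc)"
    by (simp add: convex_mapping_def image_image)
  \<comment> \<open>Here \<open>Q w = Q 0 + \<i> s w + r q w\<close>, and
    \<open>Im (\<i> s w) = s Re w\<close> depends only on the coordinate that the shear keeps; hence
    \<open>L\<close> can act on sheared points.\<close>
  define L where "L = (\<lambda>z. Complex (Re z) (r * Im z + s * Re z))"
  have L: "linear L"
    by (rule linearI) (auto simp: L_def complex_eq_iff algebra_simps)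
  have eq: "vertical_shear Q w = \<i> * Im (Q 0) + L (vertical_shear q w)" for w
    using r by (simp add: vertical_shear_def L_def q_def complex_eq_iff)
  have "vertical_shear Q ` \<phi> ` unit_disc =
      (\<lambda>z. \<i> * Im (Q 0) + z) ` L ` vertical_shear q ` \<phi> ` unit_disc"
    by (simp add: image_image eq)
  also have "convex \<dots>"
    by (intro convex_translation convex_linear_image L C)
  finally show ?thesis .
qed

section \<open>Invariance of the domain under vertical translations\<close>

text \<open>The parameters \<open>s\<close> with \<open>w + \<i> s\<close> in \<open>D\<close> form
  an open set, neither empty nor the whole line. By connectedness it has a frontier point, which
  openness keeps outside the set.\<close>

lemma vertical_boundary_point:
  assumes D: "open D" and w: "w \<in> D" and t: "w + \<i> * of_real t \<notin> D"
  obtains u where "u \<notin> D" "Re u = Re w"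
    "\<And>e. e > 0 \<Longrightarrow> \<exists>x\<in>D. Re x = Re w \<and> dist x u < e"
proof -
  define S where "S = {s. w + \<i> * of_real s \<in> D}"
  have "open ((\<lambda>s::real. w + \<i> * of_real s) -` D)"
    by (rule open_vimage[OF D]) (intro continuous_intros)
  hence S: "open S" by (simp add: S_def vimage_def)
  have "0 \<in> S" "t \<notin> S" using w t by (auto simp: S_def)
  hence "frontier S \<noteq> {}" by (intro frontier_not_empty) auto
  then obtain s where s: "s \<in> closure S" "s \<notin> S"
    using S by (auto simp: frontier_def interior_open)
  show ?thesis
  proof (rule that[of "w + \<i> * of_real s"])
    fix e :: real assume "e > 0"
    then obtain s' where s': "s' \<in> S" "dist s' s < e"
      using s(1) by (auto simp: closure_approachable)
    have "dist (w + \<i> * of_real s') (w + \<i> * of_real s) = dist s' s"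
    proof -
      have "(w + \<i> * of_real s') - (w + \<i> * of_real s) = \<i> * of_real (s' - s)"
        by (simp add: algebra_simps)
      thus ?thesis unfolding dist_norm by (simp only: norm_mult norm_ii norm_of_real) simp
    qed
    thus "\<exists>x\<in>D. Re x = Re w \<and> dist x (w + \<i> * of_real s) < e"
      using s' by (intro bexI[of _ "w + \<i> * of_real s'"]) (auto simp: S_def)
  qed (use s in \<open>auto simp: S_def\<close>)
qed

text \<open>Separation gives the weak inequality; openness makes it strict, since a point of
  \<open>D\<close> on the line could be pushed across it inside \<open>D\<close>. The multiplier
  \<open>m\<close> is the conjugate of the normal vector.\<close>

lemma open_convex_separate_point:
  fixes D :: "complex set"
  assumes "open D" "convex D" "u \<notin> D"
  obtains m where "m \<noteq> 0" "\<And>x. x \<in> D \<Longrightarrow> Re (m * (x - u)) > 0"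
proof (cases "D = {}")
  case True
  thus ?thesis using that[of 1] by simp
next
  case False
  then obtain a b where a: "a \<noteq> 0" "inner a u \<le> b" "\<And>x. x \<in> D \<Longrightarrow> inner a x \<ge> b"
    using separating_hyperplane_sets[of "{u}" D] assms by auto
  have ge: "Re (cnj a * (x - u)) \<ge> 0" if "x \<in> D" for x
    using a(2) a(3)[OF that] by (simp add: inner_complex_def algebra_simps)
  have "Re (cnj a * (x - u)) > 0" if x: "x \<in> D" for x
  proof -
    obtain e where e: "e > 0" "ball x e \<subseteq> D" using assms x open_contains_ball by blast
    define d where "d = e / (2 * cmod a)"
    have d: "d > 0" using e a by (simp add: d_def)
    have "x - of_real d * a \<in> ball x e"
      using e a by (simp add: dist_norm norm_mult d_def norm_divide)
    hence "Re (cnj a * (x - of_real d * a - u)) \<ge> 0" using e ge by blast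
    moreover have "cnj a * (x - of_real d * a - u) = cnj a * (x - u) - of_real (d * (cmod a)\<^sup>2)"
      using complex_norm_square[of a] by (simp add: algebra_simps)
    ultimately have "Re (cnj a * (x - u)) \<ge> d * (cmod a)\<^sup>2" by simp
    moreover have "d * (cmod a)\<^sup>2 > 0" using d a by simp
    ultimately show ?thesis by linarith
  qed
  thus ?thesis using that[of "cnj a"] a(1) by simp
qed

text \<open>If \<open>w + \<i> t\<close> left \<open>D\<close>, there would be a boundary point \<open>u\<close> above or below \<open>w\<close>.  With a
  supporting line at \<open>u\<close> encoded by \<open>m\<close>, the function \<open>P x = 1 / (m (x - u))\<close> has positive real
  part, and the logarithmic singularity of its primitive makes the sheared domain unbounded on the
  vertical line through \<open>w\<close> but, on one side, bounded on every other vertical line.\<close>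

lemma vertically_invariant:
  assumes D: "open D" "convex D"
    and shear: "\<And>Q P. (\<And>w. w \<in> D \<Longrightarrow> (Q has_field_derivative P w) (at w)) \<Longrightarrow>
        (\<And>w. w \<in> D \<Longrightarrow> Re (P w) > 0) \<Longrightarrow> convex (vertical_shear Q ` D)"
    and w: "w \<in> D"
  shows "w + \<i> * of_real t \<in> D"
proof (rule ccontr)
  assume "w + \<i> * of_real t \<notin> D"
  then obtain u where u: "u \<notin> D" "Re u = Re w"
    and app: "\<And>e. e > 0 \<Longrightarrow> \<exists>x\<in>D. Re x = Re w \<and> dist x u < e"
    using vertical_boundary_point D(1) w by blast
  obtain m where m: "m \<noteq> 0" and sep: "\<And>x. x \<in> D \<Longrightarrow> Re (m * (x - u)) > 0"
    using open_convex_separate_point[OF D u(1)] by blast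
  \<comment> \<open>As \<open>w - u\<close> is purely imaginary, a real \<open>m\<close> would give
    real part 0: the supporting line cannot be vertical.\<close>
  have Im_m: "Im m \<noteq> 0" using sep[OF w] u(2) by auto
  define Q where "Q = (\<lambda>x. Ln (m * (x - u)) / m)"
  have nonpos: "m * (x - u) \<notin> \<real>\<^sub>\<le>\<^sub>0" if "x \<in> D" for x
    using sep[OF that] by (auto simp: complex_nonpos_Reals_iff)
  have "convex (vertical_shear Q ` D)"
  proof (rule shear)
    fix x assume x: "x \<in> D"
    hence xu: "x \<noteq> u" using u by auto
    show "(Q has_field_derivative 1 / (m * (x - u))) (at x)"
      unfolding Q_def using nonpos[OF x] m xu
      by (auto intro!: derivative_eq_intros simp: field_simps)
    show "Re (1 / (m * (x - u))) > 0"
      using sep[OF x] m xu by (subst Re_divide) (auto simp: sum_power2_gt_zero_iff complex_eq_iff)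
  qed
  define c where "c = \<bar>Im m\<bar> / (cmod m)\<^sup>2"
  define e where "e = pi * \<bar>Re m\<bar> / (cmod m)\<^sup>2"
  have c: "c > 0" using Im_m m by (simp add: c_def)
  \<comment> \<open>Dividing by \<open>m\<close> multiplies the logarithm by
    \<open>cnj m / |m|^2\<close>. Its argument contributes at most \<open>e\<close>, its modulus the
    logarithmic term; the factor \<open>sgn (Im m)\<close> makes the singularity at \<open>u\<close>
    tend to plus infinity in either case.\<close>
  have ImQ: "\<bar>sgn (Im m) * Im (Q x) + c * ln (cmod (m * (x - u)))\<bar> \<le> e" if x: "x \<in> D" for x
  proof -
    have z: "m * (x - u) \<noteq> 0" using nonpos[OF x] by auto
    have ImQ': "Im (Q x) = (Re m * Im (Ln (m * (x - u))) - Im m * ln (cmod (m * (x - u)))) / (cmod m)\<^sup>2"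
      using Re_Ln[OF z] by (simp add: Q_def Im_divide cmod_power2 algebra_simps)
    have "sgn (Im m) * Im (Q x) + c * ln (cmod (m * (x - u))) =
        sgn (Im m) * Re m * Im (Ln (m * (x - u))) / (cmod m)\<^sup>2"
      unfolding ImQ' c_def by (simp add: abs_sgn diff_divide_distrib algebra_simps)
    moreover have "\<bar>Im (Ln (m * (x - u)))\<bar> \<le> pi"
      using Im_Ln_le_pi[OF z] mpi_less_Im_Ln[OF z] by linarith
    hence "\<bar>Re m\<bar> * \<bar>Im (Ln (m * (x - u)))\<bar> / (cmod m)\<^sup>2 \<le> e"
      unfolding e_def mult.commute[of pi] by (intro divide_right_mono mult_left_mono) auto
    ultimately show ?thesis using Im_m by (simp add: abs_mult abs_sgn_eq)
  qed
  obtain d where d: "d > 0" "ball w d \<subseteq> D" using D(1) w open_contains_ball by blast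
  \<comment> \<open>The midpoint of the sheared \<open>x1\<close> and a sheared point over
    \<open>Re w\<close> has real part \<open>Re w + d / 4\<close>, where \<open>upper\<close> bounds
    the height by \<open>K\<close>.\<close>
  define x1 where "x1 = w + of_real (d / 2)"
  have x1: "x1 \<in> D" "Re x1 = Re w + d / 2"
    using d by (auto simp: x1_def dist_norm subset_iff norm_divide)
  define K where "K = e - c * ln (cmod m * (d / 4))"
  have upper: "sgn (Im m) * Im (Q x) \<le> K" if x: "x \<in> D" "Re x = Re w + d / 4" for x
  proof -
    have "d / 4 \<le> cmod (x - u)" using abs_Re_le_cmod[of "x - u"] x u d by simp
    hence "cmod m * (d / 4) \<le> cmod (m * (x - u))" unfolding norm_mult by (intro mult_left_mono) auto
    moreover have "0 < cmod m * (d / 4)" using m d by simp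
    ultimately have "ln (cmod m * (d / 4)) \<le> ln (cmod (m * (x - u)))"
      by (metis ln_le_cancel_iff less_le_trans)
    hence "c * ln (cmod m * (d / 4)) \<le> c * ln (cmod (m * (x - u)))" using c by simp
    thus ?thesis using ImQ[OF x(1)] unfolding K_def by linarith
  qed
  \<comment> \<open>With heights multiplied by \<open>sgn (Im m)\<close>, \<open>Y\<close> is the
    height over \<open>Re w\<close> at which the midpoint with the sheared \<open>x1\<close> reaches
    \<open>K\<close>; \<open>\<epsilon>\<close> is the distance from \<open>u\<close> below which
    \<open>ImQ\<close> forces heights above \<open>Y\<close>.\<close>
  define Y where "Y = 2 * K - sgn (Im m) * Im (Q x1)"
  define \<epsilon> where "\<epsilon> = exp (- (Y + e) / c) / cmod m"
  have "\<epsilon> > 0" using m by (simp add: \<epsilon>_def)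
  then obtain x0 where x0: "x0 \<in> D" "Re x0 = Re w" "dist x0 u < \<epsilon>" using app by blast
  have "x0 \<noteq> u" using x0 u by auto
  have "cmod (m * (x0 - u)) < exp (- (Y + e) / c)"
    using x0(3) m by (simp add: \<epsilon>_def dist_norm norm_mult pos_less_divide_eq mult.commute)
  moreover have "cmod (m * (x0 - u)) > 0" using m \<open>x0 \<noteq> u\<close> by simp
  ultimately have "ln (cmod (m * (x0 - u))) < - (Y + e) / c"
    by (metis exp_gt_zero ln_exp ln_less_cancel_iff)
  hence "c * ln (cmod (m * (x0 - u))) < - (Y + e)"
    using c by (simp add: field_simps)
  hence big: "sgn (Im m) * Im (Q x0) > Y" using ImQ[OF x0(1)] by linarith
  have "(1 / 2) *\<^sub>R vertical_shear Q x0 + (1 / 2) *\<^sub>R vertical_shear Q x1 \<in> vertical_shear Q ` D"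
    by (rule convexD[OF \<open>convex (vertical_shear Q ` D)\<close>]) (use x0 x1 in auto)
  then obtain x where x: "x \<in> D"
    "vertical_shear Q x = (1 / 2) *\<^sub>R vertical_shear Q x0 + (1 / 2) *\<^sub>R vertical_shear Q x1"
    by auto
  from arg_cong[OF x(2), of Re] arg_cong[OF x(2), of Im]
  have "Re x = Re w + d / 4" and "Im (Q x) = (Im (Q x0) + Im (Q x1)) / 2"
    using x0 x1 by (auto simp: vertical_shear_def field_simps)
  with upper[OF x(1)] have "sgn (Im m) * ((Im (Q x0) + Im (Q x1)) / 2) \<le> K" by simp
  thus False using big unfolding Y_def by (simp add: algebra_simps)
qed

section \<open>Rigidity of conformal maps of the disc, and open intervals\<close>

text \<open>The Schwarz lemma for \<open>\<sigma>\<close> and for its inverse forces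
  \<open>cmod (\<sigma> (1/2)) = 1/2\<close>, and its equality case gives a rotation.\<close>

lemma disc_automorphism_fixing_0:
  assumes hol: "\<sigma> holomorphic_on unit_disc" and inj: "inj_on \<sigma> unit_disc"
    and im: "\<sigma> ` unit_disc = unit_disc" and zero: "\<sigma> 0 = 0"
  obtains \<eta> where "cmod \<eta> = 1" "\<And>z. z \<in> unit_disc \<Longrightarrow> \<sigma> z = \<eta> * z"
proof -
  obtain \<tau> where "\<tau> holomorphic_on \<sigma> ` unit_disc"
    and \<tau>: "\<And>z. z \<in> unit_disc \<Longrightarrow> \<tau> (\<sigma> z) = z"
    using holomorphic_has_inverse[OF hol open_ball inj] by metis
  hence hol\<tau>: "\<tau> holomorphic_on unit_disc" by (simp add: im)
  have \<tau>0: "\<tau> 0 = 0" using \<tau>[of 0] zero by simp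
  have \<tau>1: "cmod (\<tau> z) < 1" if "cmod z < 1" for z
  proof -
    have "z \<in> \<sigma> ` unit_disc" using that im by simp
    thus ?thesis using \<tau> by auto
  qed
  have \<sigma>1: "cmod (\<sigma> z) < 1" if "cmod z < 1" for z
    using im that by (metis image_eqI mem_ball_0)
  have "cmod (\<tau> (\<sigma> (1/2))) \<le> cmod (\<sigma> (1/2))"
    by (rule Schwarz_Lemma(1)[OF hol\<tau> \<tau>0 \<tau>1]) (auto intro!: \<sigma>1 simp: norm_divide)
  moreover have "cmod (\<sigma> (1/2)) \<le> cmod (1/2)"
    by (rule Schwarz_Lemma(1)[OF hol zero \<sigma>1]) (auto simp: norm_divide)
  ultimately have "cmod (\<sigma> (1/2)) = cmod (1/2)"
    using \<tau>[of "1/2"] by (simp add: norm_divide)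
  hence "\<exists>z. cmod z < 1 \<and> z \<noteq> 0 \<and> cmod (\<sigma> z) = cmod z"
    by (intro exI[of _ "1/2"]) (simp add: norm_divide)
  with Schwarz_Lemma(3)[OF hol zero \<sigma>1, of 0] that show ?thesis by auto
qed

text \<open>The Cayley transform sending \<open>k 0\<close> to 0 turns \<open>k\<close> into a disc
  automorphism fixing 0, hence into multiplication by \<open>\<eta>\<close>. The value of
  \<open>deriv k 0\<close> will tie \<open>\<eta>\<close> to the normalization of
  \<open>\<phi>\<close>.\<close>

lemma disc_onto_upper_halfplane:
  assumes hol: "k holomorphic_on unit_disc" and inj: "inj_on k unit_disc"
    and im: "k ` unit_disc = {z. Im z > 0}"
  obtains \<eta> where "cmod \<eta> = 1"
    "\<And>z. z \<in> unit_disc \<Longrightarrow> k z = (k 0 - cnj (k 0) * \<eta> * z) / (1 - \<eta> * z)"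
    "deriv k 0 = 2 * \<i> * of_real (Im (k 0)) * \<eta>"
proof -
  define c where "c = k 0"
  have c: "Im c > 0" using im unfolding c_def by (metis centre_in_ball image_eqI mem_Collect_eq zero_less_one)
  have Imk: "Im (k z) > 0" if "z \<in> unit_disc" for z using im that by blast
  define \<sigma> where "\<sigma> = (\<lambda>z. (k z - c) / (k z - cnj c))"
  have nz: "T - cnj c \<noteq> 0" if "Im T > 0" for T using that c by (auto simp: complex_eq_iff)
  have cc: "c \<noteq> cnj c" using c by (auto simp: complex_eq_iff)
  have hol\<sigma>: "\<sigma> holomorphic_on unit_disc"
    unfolding \<sigma>_def by (intro holomorphic_intros hol) (use nz Imk in auto)
  have inj\<sigma>: "inj_on \<sigma> unit_disc"
  proof (rule inj_onI)
    fix x y assume xy: "x \<in> unit_disc" "y \<in> unit_disc" "\<sigma> x = \<sigma> y"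
    hence "(k x - c) * (k y - cnj c) = (k y - c) * (k x - cnj c)"
      using nz[OF Imk[of x]] nz[OF Imk[of y]] by (simp add: \<sigma>_def field_simps)
    hence "(c - cnj c) * (k x - k y) = 0" by (simp add: algebra_simps)
    hence "k x = k y" using cc by simp
    thus "x = y" using inj xy by (auto dest: inj_onD)
  qed
  \<comment> \<open>The inverse Cayley transform, which provides preimages for the surjectivity of
    \<open>\<sigma>\<close>.\<close>
  have inv: "(c - cnj c * \<zeta>) / (1 - \<zeta>) \<in> {z. Im z > 0}" if "cmod \<zeta> < 1" for \<zeta>
  proof -
    have n: "1 - \<zeta> \<noteq> 0" using that by auto
    have "Im ((c - cnj c * \<zeta>) / (1 - \<zeta>)) = Im c * (1 - (cmod \<zeta>)\<^sup>2) / (cmod (1 - \<zeta>))\<^sup>2"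
      by (simp add: Im_divide cmod_power2) (simp add: algebra_simps power2_eq_square)
    moreover have "(cmod \<zeta>)\<^sup>2 < 1" using that by (simp add: power_less_one_iff)
    ultimately show ?thesis using c n by simp
  qed
  have "\<sigma> ` unit_disc = unit_disc"
  proof (intro equalityI subsetI)
    fix x assume "x \<in> \<sigma> ` unit_disc"
    then obtain z where z: "z \<in> unit_disc" "x = \<sigma> z" by auto
    have "(cmod (k z - c))\<^sup>2 < (cmod (k z - cnj c))\<^sup>2"
      using mult_pos_pos[OF Imk[OF z(1)] c] unfolding cmod_power2
      by (simp add: power2_eq_square algebra_simps)
    hence "cmod (k z - c) < cmod (k z - cnj c)" by (rule power_less_imp_less_base) simp
    thus "x \<in> unit_disc" using z(2) nz[OF Imk[OF z(1)]] by (simp add: \<sigma>_def norm_divide)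
  next
    fix x assume x: "x \<in> unit_disc"
    hence "(c - cnj c * x) / (1 - x) \<in> k ` unit_disc" unfolding im by (intro inv) simp
    then obtain z where z: "z \<in> unit_disc" "k z = (c - cnj c * x) / (1 - x)"
      by (elim imageE) simp
    have "1 - x \<noteq> 0" using x by auto
    hence "(k z - c) = x * (k z - cnj c)" by (simp add: z field_simps)
    hence "\<sigma> z = x" using nz[OF Imk[OF z(1)]] by (simp add: \<sigma>_def)
    thus "x \<in> \<sigma> ` unit_disc" using z by blast
  qed
  moreover have "\<sigma> 0 = 0" by (simp add: \<sigma>_def c_def)
  ultimately obtain \<eta> where \<eta>: "cmod \<eta> = 1" "\<And>z. z \<in> unit_disc \<Longrightarrow> \<sigma> z = \<eta> * z"
    using disc_automorphism_fixing_0[OF hol\<sigma> inj\<sigma>] by metis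
  have n1: "1 - \<eta> * z \<noteq> 0" if "z \<in> unit_disc" for z
    using that \<eta>(1) by (metis eq_iff_diff_eq_0 less_irrefl mem_ball_0 mult_1 norm_mult norm_one)
  have keq: "k z = (c - cnj c * \<eta> * z) / (1 - \<eta> * z)" if z: "z \<in> unit_disc" for z
  proof -
    have "k z - c = \<eta> * z * (k z - cnj c)"
      using \<eta>(2)[OF z] nz[OF Imk[OF z]] by (simp add: \<sigma>_def field_simps)
    thus ?thesis using n1[OF z] by (simp add: field_simps)
  qed
  have "(k has_field_derivative (c - cnj c) * \<eta>) (at 0)"
  proof (rule has_field_derivative_transform_within_open[where S = unit_disc])
    show "((\<lambda>z. (c - cnj c * \<eta> * z) / (1 - \<eta> * z)) has_field_derivative (c - cnj c) * \<eta>) (at 0)"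
      by (auto intro!: derivative_eq_intros simp: algebra_simps)
  qed (simp_all add: keq)
  hence "deriv k 0 = (c - cnj c) * \<eta>" by (rule DERIV_imp_deriv)
  also have "c - cnj c = 2 * \<i> * of_real (Im c)" by (simp add: complex_diff_cnj)
  finally show ?thesis using that[OF \<eta>(1)] keq by (simp only: c_def)
qed

text \<open>The inverse would be a bounded entire function, hence constant, yet it takes the values
  0 and 1/2.\<close>

lemma no_injective_disc_onto_plane:
  assumes hol: "\<phi> holomorphic_on unit_disc" and inj: "inj_on \<phi> unit_disc"
  shows "\<phi> ` unit_disc \<noteq> UNIV"
proof
  assume U: "\<phi> ` unit_disc = UNIV"
  obtain \<tau> where "\<tau> holomorphic_on \<phi> ` unit_disc"
    and \<tau>: "\<And>z. z \<in> unit_disc \<Longrightarrow> \<tau> (\<phi> z) = z"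
    using holomorphic_has_inverse[OF hol open_ball inj] by metis
  hence "\<tau> holomorphic_on UNIV" by (simp add: U)
  moreover have "range \<tau> = unit_disc"
    using \<tau> by (simp flip: U add: image_image)
  ultimately have "\<tau> constant_on UNIV"
    using Liouville_theorem by simp
  then obtain a where a: "\<And>w. \<tau> w = a" by (auto simp: constant_on_def)
  have "0 = a" "1 / 2 = a" using \<tau>[of 0] \<tau>[of "1/2"] a by (auto simp: norm_divide)
  thus False by simp
qed

text \<open>Openness keeps infimum and supremum out of \<open>I\<close>, so each end is either an
  excluded finite bound or infinite.\<close>

lemma open_interval_real_cases:
  fixes I :: "real set"
  assumes "open I" "is_interval I" "x \<in> I"
  shows "I = UNIV \<or> (\<exists>a. I = {a<..}) \<or> (\<exists>b. I = {..<b}) \<or> (\<exists>a b. I = {a<..<b})"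
proof -
  have lo: "\<exists>y\<in>I. y < z" if z: "z \<in> I" for z
  proof -
    obtain e where e: "e > 0" "ball z e \<subseteq> I" using assms z open_contains_ball by blast
    hence "z - e / 2 \<in> I" by (auto simp: dist_norm subset_iff)
    thus ?thesis using e by (intro bexI[of _ "z - e/2"]) auto
  qed
  have hi: "\<exists>y\<in>I. z < y" if z: "z \<in> I" for z
  proof -
    obtain e where e: "e > 0" "ball z e \<subseteq> I" using assms z open_contains_ball by blast
    hence "z + e / 2 \<in> I" by (auto simp: dist_norm subset_iff)
    thus ?thesis using e by (intro bexI[of _ "z + e/2"]) auto
  qed
  have mid: "z \<in> I" if "y \<in> I" "y' \<in> I" "y < z" "z < y'" for y y' z
    using assms(2) that unfolding is_interval_1 by (meson less_imp_le)
  \<comment> \<open>By \<open>mid\<close>, a point with elements of \<open>I\<close> on both sides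
    lies in \<open>I\<close>, so the two ends of a candidate \<open>J\<close> can be checked
    separately.\<close>
  have eqI: "I = J" if "\<And>z. z \<in> I \<Longrightarrow> z \<in> J" "\<And>z. z \<in> J \<Longrightarrow> \<exists>y\<in>I. y < z" "\<And>z. z \<in> J \<Longrightarrow> \<exists>y\<in>I. z < y"
    for J using that mid by (meson subsetI subset_antisym)
  have A: "(bdd_below I \<and> (\<forall>z\<in>I. Inf I < z) \<and> (\<forall>z. Inf I < z \<longrightarrow> (\<exists>y\<in>I. y < z))) \<or>
      (\<forall>z. \<exists>y\<in>I. y < z)"
  proof (cases "bdd_below I")
    case True
    hence "Inf I < z" if "z \<in> I" for z
      using lo[OF that] cInf_lower[OF _ True] by force
    moreover have "\<exists>y\<in>I. y < z" if "Inf I < z" for z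
      using that assms(3) True by (subst (asm) cInf_less_iff) auto
    ultimately show ?thesis using True by blast
  qed (auto simp: bdd_below_def not_le)
  have B: "(bdd_above I \<and> (\<forall>z\<in>I. z < Sup I) \<and> (\<forall>z. z < Sup I \<longrightarrow> (\<exists>y\<in>I. z < y))) \<or>
      (\<forall>z. \<exists>y\<in>I. z < y)"
  proof (cases "bdd_above I")
    case True
    hence "z < Sup I" if "z \<in> I" for z
      using hi[OF that] cSup_upper[OF _ True] by force
    moreover have "\<exists>y\<in>I. z < y" if "z < Sup I" for z
      using that assms(3) True by (subst (asm) less_cSup_iff) auto
    ultimately show ?thesis using True by blast
  qed (auto simp: bdd_above_def not_le)
  from A B show ?thesis
  proof (elim disjE conjE)
    assume "\<forall>z\<in>I. Inf I < z" "\<forall>z. Inf I < z \<longrightarrow> (\<exists>y\<in>I. y < z)"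
      "\<forall>z\<in>I. z < Sup I" "\<forall>z. z < Sup I \<longrightarrow> (\<exists>y\<in>I. z < y)"
    hence "I = {Inf I<..<Sup I}" by (intro eqI) auto
    thus ?thesis by blast
  next
    assume "\<forall>z\<in>I. Inf I < z" "\<forall>z. Inf I < z \<longrightarrow> (\<exists>y\<in>I. y < z)" "\<forall>z. \<exists>y\<in>I. z < y"
    hence "I = {Inf I<..}" by (intro eqI) auto
    thus ?thesis by blast
  next
    assume "\<forall>z. \<exists>y\<in>I. y < z" "\<forall>z\<in>I. z < Sup I" "\<forall>z. z < Sup I \<longrightarrow> (\<exists>y\<in>I. z < y)"
    hence "I = {..<Sup I}" by (intro eqI) auto
    thus ?thesis by blast
  next
    assume "\<forall>z. \<exists>y\<in>I. y < z" "\<forall>z. \<exists>y\<in>I. z < y"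
    hence "I = UNIV" by (intro eqI) auto
    thus ?thesis by blast
  qed
qed

section \<open>Normalized conformal maps onto vertical half-planes and strips\<close>

text \<open>Shifting by \<open>a\<close> and multiplying by \<open>\<i>\<close> leads to the upper
  half-plane. The derivative at 0 gives \<open>- 2 a \<eta> = 1\<close>; as \<open>a < 0\<close>,
  moduli force \<open>a = - 1/2\<close>, and then \<open>\<eta> = 1\<close>.\<close>

lemma onto_right_halfplane_eq_halfplane_map:
  assumes hol: "\<phi> holomorphic_on unit_disc" and inj: "inj_on \<phi> unit_disc"
    and zero: "\<phi> 0 = 0" and d1: "deriv \<phi> 0 = 1"
    and im: "\<phi> ` unit_disc = {w. a < Re w}" and z: "z \<in> unit_disc"
  shows "\<phi> z = halfplane_map z"
proof -
  define k where "k = (\<lambda>z. \<i> * (\<phi> z - of_real a))"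
  have "\<phi> 0 \<in> {w. a < Re w}" unfolding im[symmetric] by (rule imageI) simp
  hence a: "a < 0" using zero by simp
  have "k ` unit_disc = (\<lambda>w. \<i> * (w - of_real a)) ` {w. a < Re w}"
    by (simp add: k_def image_image flip: im)
  also have "\<dots> = {z. Im z > 0}"
  proof (intro equalityI subsetI)
    fix y :: complex assume "y \<in> {z. Im z > 0}"
    thus "y \<in> (\<lambda>w. \<i> * (w - of_real a)) ` {w. a < Re w}"
      by (intro image_eqI[of _ _ "of_real a - \<i> * y"]) (auto simp: algebra_simps)
  qed auto
  finally have imk: "k ` unit_disc = {z. Im z > 0}" .
  have holk: "k holomorphic_on unit_disc" unfolding k_def by (intro holomorphic_intros hol)
  have injk: "inj_on k unit_disc" using inj by (auto simp: k_def inj_on_def)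
  have k0: "k 0 = - \<i> * of_real a" by (simp add: k_def zero)
  have dk: "deriv k 0 = \<i>"
    using holomorphic_derivI[OF hol open_ball, of 0] d1 unfolding k_def
    by (intro DERIV_imp_deriv) (auto intro!: derivative_eq_intros)
  obtain \<eta> where \<eta>: "cmod \<eta> = 1"
    "\<And>z. z \<in> unit_disc \<Longrightarrow> k z = (k 0 - cnj (k 0) * \<eta> * z) / (1 - \<eta> * z)"
    "deriv k 0 = 2 * \<i> * of_real (Im (k 0)) * \<eta>"
    using disc_onto_upper_halfplane[OF holk injk imk] by metis
  have "\<i> * (of_real (- 2 * a) * \<eta>) = deriv k 0" by (subst \<eta>(3)) (simp add: k0)
  hence e: "of_real (- 2 * a) * \<eta> = 1" using dk by (metis complex_i_not_zero mult.right_neutral mult_cancel_left)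
  from arg_cong[OF this, of cmod] have "- 2 * a = 1"
    using \<eta>(1) a by (simp only: norm_mult norm_of_real) simp
  hence a2: "a = - 1/2" by simp
  hence \<eta>1: "\<eta> = 1" using e by simp
  have "1 - z \<noteq> 0" using z by auto
  have "\<i> * (\<phi> z + 1/2) = \<i> * (1/2 + z/2) / (1 - z)"
    using \<eta>(2)[OF z] by (simp add: \<eta>1 k0) (simp add: k_def a2 algebra_simps)
  hence "\<phi> z + 1/2 = (1/2 + z/2) / (1 - z)"
    by (metis complex_i_not_zero mult_cancel_left times_divide_eq_right)
  hence "\<phi> z = (1/2 + z/2) / (1 - z) - 1/2" by (simp add: eq_diff_eq)
  also have "(1/2 + z/2) / (1 - z) - 1/2 = z / (1 - z)"
    using \<open>1 - z \<noteq> 0\<close> by (simp add: field_simps)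
  finally show ?thesis by (simp add: halfplane_map_def)
qed

text \<open>Conjugation by negation keeps the normalization and turns the image into a right
  half-plane.\<close>

lemma onto_left_halfplane_eq_rotated_halfplane_map:
  assumes hol: "\<phi> holomorphic_on unit_disc" and inj: "inj_on \<phi> unit_disc"
    and zero: "\<phi> 0 = 0" and d1: "deriv \<phi> 0 = 1"
    and im: "\<phi> ` unit_disc = {w. Re w < b}" and z: "z \<in> unit_disc"
  shows "\<phi> z = rotation (-1) halfplane_map z"
proof -
  define \<psi> where "\<psi> = (\<lambda>z. - \<phi> (- z))"
  have neg: "uminus ` unit_disc = unit_disc"
    by (rule subset_antisym) (auto intro: image_eqI[of _ _ "- x" for x])
  have hol': "\<psi> holomorphic_on unit_disc"
    unfolding \<psi>_def
    by (intro holomorphic_intros holomorphic_on_compose_gen[of uminus unit_disc \<phi> unit_disc, unfolded o_def] hol)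
      auto
  have inj': "inj_on \<psi> unit_disc" by (rule inj_onI) (use inj_onD[OF inj, of "- x" "- y" for x y] in \<open>auto simp: \<psi>_def\<close>)
  have "\<psi> ` unit_disc = uminus ` \<phi> ` uminus ` unit_disc" by (simp add: \<psi>_def image_image)
  also have "\<dots> = uminus ` {w. Re w < b}" by (simp only: neg im)
  also have "\<dots> = {w. - b < Re w}"
  proof (intro equalityI subsetI)
    fix x assume "x \<in> {w. - b < Re w}"
    thus "x \<in> uminus ` {w. Re w < b}" by (intro image_eqI[of _ _ "- x"]) auto
  qed auto
  finally have im': "\<psi> ` unit_disc = {w. - b < Re w}" .
  have "(\<phi> has_field_derivative 1) (at (- 0))"
    using holomorphic_derivI[OF hol open_ball, of 0] d1 by simp
  hence "((\<lambda>z. \<phi> (- z)) has_field_derivative 1 * (- 1)) (at 0)"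
    by (rule DERIV_chain2) (auto intro!: derivative_eq_intros)
  hence d': "deriv \<psi> 0 = 1"
    unfolding \<psi>_def by (intro DERIV_imp_deriv) (auto intro!: derivative_eq_intros)
  have "\<psi> (- z) = halfplane_map (- z)"
    by (rule onto_right_halfplane_eq_halfplane_map[OF hol' inj' _ d' im']) (use z zero in \<open>auto simp: \<psi>_def\<close>)
  thus ?thesis by (simp add: \<psi>_def rotation_def) (metis minus_minus)
qed

text \<open>An exponential carries the strip onto the upper half-plane and 0 to a point
  \<open>c\<close> of the unit circle; the normalization then shows that \<open>c\<close> is the
  parameter \<open>\<mu>\<close>.\<close>

lemma onto_strip_eq_strip_map:
  assumes hol: "\<phi> holomorphic_on unit_disc" and inj: "inj_on \<phi> unit_disc"
    and zero: "\<phi> 0 = 0" and d1: "deriv \<phi> 0 = 1"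
    and im: "\<phi> ` unit_disc = {w. a < Re w \<and> Re w < b}"
  obtains \<mu> where "\<mu> \<in> sphere 0 1 - {-1, 1}" "\<And>z. z \<in> unit_disc \<Longrightarrow> \<phi> z = strip_map \<mu> z"
proof -
  have "\<phi> 0 \<in> {w. a < Re w \<and> Re w < b}" unfolding im[symmetric] by (rule imageI) simp
  hence ab: "a < 0" "0 < b" using zero by auto
  \<comment> \<open>Rescales the strip to width \<open>pi\<close>, so that \<open>E\<close> has
    arguments exactly in the open interval from 0 to \<open>pi\<close> and \<open>Ln\<close> inverts
    it.\<close>
  define \<kappa> where "\<kappa> = pi / (b - a)"
  have \<kappa>: "\<kappa> > 0" using ab by (simp add: \<kappa>_def)
  have \<kappa>ab: "\<kappa> * (b - a) = pi" using ab by (simp add: \<kappa>_def)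
  define E where "E = (\<lambda>w. exp (\<i> * of_real \<kappa> * (w - of_real a)))"
  define k where "k = (\<lambda>z. E (\<phi> z))"
  have arg: "Im (\<i> * of_real \<kappa> * (w - of_real a)) \<in> {0<..<pi}" if "a < Re w" "Re w < b" for w
    using that \<kappa> \<kappa>ab mult_strict_left_mono[of "Re w - a" "b - a" \<kappa>] by simp
  have LnE: "Ln (E w) = \<i> * of_real \<kappa> * (w - of_real a)" if "a < Re w" "Re w < b" for w
    unfolding E_def by (rule Ln_exp) (use arg[OF that] in \<open>auto simp del: Im_complex_of_real\<close>)
  have "k ` unit_disc = E ` {w. a < Re w \<and> Re w < b}"
    by (simp add: k_def image_image flip: im)
  also have "\<dots> = {z. Im z > 0}"
  proof (intro equalityI subsetI)
    fix y assume "y \<in> E ` {w. a < Re w \<and> Re w < b}"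
    then obtain w where w: "y = E w" "a < Re w" "Re w < b" by auto
    show "y \<in> {z. Im z > 0}"
      unfolding w(1) E_def using arg[OF w(2,3)] by (simp add: Im_exp sin_gt_zero)
  next
    fix y :: complex assume y: "y \<in> {z. Im z > 0}"
    define w where "w = of_real a + Ln y / (\<i> * of_real \<kappa>)"
    have "y \<noteq> 0" using y by auto
    have "\<i> * of_real \<kappa> * (w - of_real a) = Ln y" using \<kappa> by (simp add: w_def)
    hence "E w = y" using \<open>y \<noteq> 0\<close> by (simp add: E_def)
    moreover have "Re w = a + Im (Ln y) / \<kappa>" using \<kappa> by (simp add: w_def Re_divide power2_eq_square)
    moreover have "0 < Im (Ln y) \<and> Im (Ln y) < pi" using y by (intro Im_Ln_pos_lt_imp) auto
    moreover from this \<kappa> have "0 < Im (Ln y) / \<kappa>" "Im (Ln y) / \<kappa> < b - a"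
      using \<kappa>ab by (auto simp: pos_divide_less_eq mult.commute)
    ultimately show "y \<in> E ` {w. a < Re w \<and> Re w < b}"
      by (intro image_eqI[of _ _ w]) auto
  qed
  finally have imk: "k ` unit_disc = {z. Im z > 0}" .
  have strip: "a < Re (\<phi> z)" "Re (\<phi> z) < b" if "z \<in> unit_disc" for z
    using im that by blast+
  have injk: "inj_on k unit_disc"
  proof (rule inj_onI)
    fix x y assume xy: "x \<in> unit_disc" "y \<in> unit_disc" "k x = k y"
    hence "Ln (E (\<phi> x)) = Ln (E (\<phi> y))" by (simp add: k_def)
    hence "\<phi> x = \<phi> y" using \<kappa> LnE[OF strip[OF xy(1)]] LnE[OF strip[OF xy(2)]] by simp
    thus "x = y" using inj xy by (auto dest: inj_onD)
  qed
  have holk: "k holomorphic_on unit_disc" unfolding k_def E_def by (intro holomorphic_intros hol)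
  have k0: "k 0 = exp (- \<i> * of_real (\<kappa> * a))" by (simp add: k_def E_def zero mult.assoc)
  have dk: "deriv k 0 = \<i> * of_real \<kappa> * k 0"
    using holomorphic_derivI[OF hol open_ball, of 0] d1 zero unfolding k_def E_def
    by (intro DERIV_imp_deriv) (auto intro!: derivative_eq_intros)
  obtain \<eta> where \<eta>: "cmod \<eta> = 1"
    "\<And>z. z \<in> unit_disc \<Longrightarrow> k z = (k 0 - cnj (k 0) * \<eta> * z) / (1 - \<eta> * z)"
    "deriv k 0 = 2 * \<i> * of_real (Im (k 0)) * \<eta>"
    using disc_onto_upper_halfplane[OF holk injk imk] by metis
  define c where "c = k 0"
  have c1: "cmod c = 1" unfolding c_def k0 by (simp add: norm_exp)
  have "k 0 \<in> {z. Im z > 0}" unfolding imk[symmetric] by (rule imageI) simp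
  hence cpos: "Im c > 0" by (simp add: c_def)
  \<comment> \<open>Two expressions for \<open>deriv k 0\<close> are equated. Both \<open>c\<close>
    and \<open>\<eta>\<close> have modulus 1, so moduli give \<open>\<kappa> = 2 * Im c\<close>,
    whence \<open>\<eta> = c\<close>.\<close>
  have e: "of_real \<kappa> * c = of_real (2 * Im c) * \<eta>"
    using \<eta>(3) dk by (simp add: c_def mult_ac)
  from arg_cong[OF this, of cmod] have \<kappa>c: "\<kappa> = 2 * Im c"
    using c1 \<eta>(1) \<kappa> cpos by (simp only: norm_mult norm_of_real)
  hence \<eta>c: "\<eta> = c" using e \<kappa> by simp
  have mem: "c \<in> sphere 0 1 - {-1, 1}" using c1 cpos by auto
  have "\<phi> z = strip_map c z" if z: "z \<in> unit_disc" for z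
  proof -
    have "c * exp (\<i> * of_real \<kappa> * \<phi> z) = k z"
      unfolding c_def k0 by (simp add: k_def E_def algebra_simps flip: exp_add)
    also have "\<dots> = c * ((1 - cnj c * z) / (1 - c * z))"
      using \<eta>(2)[OF z] by (simp add: \<eta>c algebra_simps flip: c_def)
    finally have ex: "exp (\<i> * of_real \<kappa> * \<phi> z) = (1 - cnj c * z) / (1 - c * z)"
      using c1 by (metis mult_cancel_left norm_zero zero_neq_one)
    \<comment> \<open>Since \<open>a < 0 < b\<close> and \<open>\<kappa> * (b - a) = pi\<close>, the
      number \<open>\<kappa> * Re (\<phi> z)\<close> has absolute value below \<open>pi\<close>, so
      the principal branch recovers the exponent.\<close>
    have "Ln (exp (\<i> * of_real \<kappa> * \<phi> z)) = \<i> * of_real \<kappa> * \<phi> z"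
    proof (rule Ln_exp)
      have "\<kappa> * a < \<kappa> * Re (\<phi> z)" "\<kappa> * Re (\<phi> z) < \<kappa> * b" "\<kappa> * a < 0" "0 < \<kappa> * b"
        using strip[OF z] \<kappa> ab by (auto simp: mult_pos_neg)
      moreover have "\<kappa> * b - \<kappa> * a = pi" using \<kappa>ab by (simp add: algebra_simps)
      ultimately show "- pi < Im (\<i> * of_real \<kappa> * \<phi> z)" "Im (\<i> * of_real \<kappa> * \<phi> z) \<le> pi"
        by auto
    qed
    hence "Ln ((1 - cnj c * z) / (1 - c * z)) = 2 * \<i> * of_real (Im c) * \<phi> z"
      unfolding ex by (simp add: \<kappa>c mult_ac)
    thus ?thesis using cpos by (simp add: strip_map_def)
  qed
  with mem that show ?thesis by blast
qed

section \<open>Classification of the invariant domains and conclusion\<close>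

text \<open>Vertical invariance makes the domain the preimage under \<open>Re\<close> of its real
  trace \<open>I\<close>, an open interval containing 0. The whole line is impossible; each other
  shape determines \<open>\<phi>\<close>.\<close>

lemma vertically_invariant_imp_family_A:
  assumes hol: "\<phi> holomorphic_on unit_disc" and inj: "inj_on \<phi> unit_disc"
    and cv: "convex (\<phi> ` unit_disc)" and zero: "\<phi> 0 = 0" and d1: "deriv \<phi> 0 = 1"
    and vert: "\<And>w t. w \<in> \<phi> ` unit_disc \<Longrightarrow> w + \<i> * of_real t \<in> \<phi> ` unit_disc"
  shows "\<exists>A\<in>family_A. \<forall>z\<in>unit_disc. \<phi> z = A z"
proof -
  define D where "D = \<phi> ` unit_disc"
  have opD: "open D"
    unfolding D_def by (rule open_mapping_thm3[OF hol _ inj]) auto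
  define I where "I = (of_real -` D :: real set)"
  have DI: "w \<in> D \<longleftrightarrow> Re w \<in> I" for w
  proof
    assume "w \<in> D"
    hence "w + \<i> * of_real (- Im w) \<in> D" using vert unfolding D_def by blast
    moreover have "w + \<i> * of_real (- Im w) = of_real (Re w)" by (simp add: complex_eq_iff)
    ultimately show "Re w \<in> I" by (simp add: I_def)
  next
    assume "Re w \<in> I"
    hence "of_real (Re w) + \<i> * of_real (Im w) \<in> D" using vert unfolding D_def I_def by blast
    thus "w \<in> D" by (simp flip: complex_eq)
  qed
  have "open I" unfolding I_def by (rule open_vimage[OF opD]) (intro continuous_intros)
  moreover have "convex I"
    unfolding I_def using cv
    by (intro convex_linear_vimage) (auto simp: D_def intro!: bounded_linear.linear bounded_linear_of_real)
  moreover have "0 \<in> I"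
    using zero by (auto simp: I_def D_def image_iff intro!: bexI[of _ 0])
  ultimately consider "I = UNIV" | a where "I = {a<..}" | b where "I = {..<b}"
    | a b where "I = {a<..<b}"
    using open_interval_real_cases[of I 0] by (auto simp: is_interval_convex_1)
  thus ?thesis
  proof cases
    case 1
    hence "D = UNIV" using DI by auto
    thus ?thesis using no_injective_disc_onto_plane[OF hol inj] by (simp add: D_def)
  next
    case (2 a)
    hence "\<phi> ` unit_disc = {w. a < Re w}" using DI by (auto simp flip: D_def)
    from onto_right_halfplane_eq_halfplane_map[OF hol inj zero d1 this] show ?thesis
      by (intro bexI[of _ halfplane_map]) (auto simp: family_A_def)
  next
    case (3 b)
    hence "\<phi> ` unit_disc = {w. Re w < b}" using DI by (auto simp flip: D_def)
    from onto_left_halfplane_eq_rotated_halfplane_map[OF hol inj zero d1 this] show ?thesis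
      by (intro bexI[of _ "rotation (-1) halfplane_map"]) (auto simp: family_A_def)
  next
    case (4 a b)
    hence "\<phi> ` unit_disc = {w. a < Re w \<and> Re w < b}" using DI by (auto simp flip: D_def)
    from onto_strip_eq_strip_map[OF hol inj zero d1 this] obtain \<mu>
      where "\<mu> \<in> sphere 0 1 - {-1, 1}" "\<And>z. z \<in> unit_disc \<Longrightarrow> \<phi> z = strip_map \<mu> z"
      by metis
    thus ?thesis by (intro bexI[of _ "strip_map \<mu>"]) (auto simp: family_A_def)
  qed
qed

theorem theorem2:
  fixes \<phi> :: "complex \<Rightarrow> complex"
  assumes "\<phi> holomorphic_on unit_disc" and "convex_mapping \<phi>"
    and "\<phi> 0 = 0" and "deriv \<phi> 0 = 1"
    and "\<And>f h g \<omega>. SH0 f h g \<Longrightarrow> schwarz_function \<omega> \<Longrightarrow>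
           (\<forall>z\<in>unit_disc. h z + g z = \<phi> z) \<Longrightarrow>
           (\<forall>z\<in>unit_disc. deriv g z / deriv h z = \<omega> z) \<Longrightarrow> convex_mapping f"
  shows "\<forall>f h g \<omega>. SH0 f h g \<longrightarrow> schwarz_function \<omega> \<longrightarrow>
           (\<forall>z\<in>unit_disc. h z + g z = \<phi> z) \<longrightarrow>
           (\<forall>z\<in>unit_disc. deriv g z / deriv h z = \<omega> z) \<longrightarrow>
           (\<exists>F H G. canonical_decomposition F H G \<and> is_rotation_of f F \<and>
             (\<exists>A\<in>family_A. \<forall>z\<in>unit_disc. H z + G z = A z))"
proof (intro allI impI)
  fix f h g \<omega>
  assume f: "SH0 f h g" and hg: "\<forall>z\<in>unit_disc. h z + g z = \<phi> z"
  have inj: "inj_on \<phi> unit_disc" and op: "open (\<phi> ` unit_disc)" and cv: "convex (\<phi> ` unit_disc)"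
    using assms(2) by (auto simp: convex_mapping_def)
  note shear = convex_vertical_shear_image[OF assms(1) inj cv assms(3,4,5)]
  have "\<exists>A\<in>family_A. \<forall>z\<in>unit_disc. \<phi> z = A z"
    by (rule vertically_invariant_imp_family_A[OF assms(1) inj cv assms(3,4)])
      (rule vertically_invariant[OF op cv shear])
  moreover have "canonical_decomposition f h g" using f by (simp add: SH0_def)
  \<comment> \<open>As \<open>h + g = \<phi>\<close> already agrees with a member of the family on
    the disc, \<open>f\<close> serves as its own \<open>F\<close> with
    \<open>\<xi> = 1\<close>.\<close>
  moreover have "is_rotation_of f f"
    unfolding is_rotation_of_def by (intro exI[of _ 1]) (simp add: rotation_def)
  ultimately show "\<exists>F H G. canonical_decomposition F H G \<and> is_rotation_of f F \<and>
      (\<exists>A\<in>family_A. \<forall>z\<in>unit_disc. H z + G z = A z)"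
    using hg by metis
qed

end
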